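(* Let $\mathbf{D}$ be a nonempty set of rooted communication graphs on $n$ processes. The number of iterations $\mathrm{TD}=\mathrm{TD}(\mathbf{D})$ of the decision procedure satisfies $\mathrm{TD}\le 2^n$.
   Context: $\Pi$ is a set of $n$ processes. A communication graph is a directed graph on $\Pi$ containing all self-loops; $\mathrm{In}_G(p)=\{q:(q,p)\in E(G)\}$. A root component of a graph is a strongly connected component with no incoming edge from outside. A graph $G$ is rooted if it has exactly one root component, whose node set is $\mathrm{Root}(G)$. A set $\mathbf{S}$ of rooted communication graphs is root-compatible if $\bigcap_{G\in\mathbf{S}}\mathrm{Root}(G)\ne\emptyset$. **Decision procedure.** $I(\mathbf{D})$ is the undirected graph with node set $\mathbf{D}$ in which $G,H$ are joined by an edge $e$ iff its label $\ell(e)=\{p\in\Pi:\mathrm{In}_G(p)=\mathrm{In}_H(p)\}$ is nonempty. Put $\mathcal{N}_1=I(\mathbf{D})$. For $i\ge2$, $\mathcal{N}_i$ has node set $\mathbf{D}$, and its edges are those edges $e$ of $\mathcal{N}_{i-1}$ for which the connected component of $\mathcal{N}_{i-1}$ containing $e$ contains a node $G$ with $\mathrm{Root}(G)\subseteq\ell(e)$. The decision procedure computes $\mathcal{N}_2,\mathcal{N}_3,\dots$ and stops at the first index $i\ge2$ such that $\mathcal{N}_i=\mathcal{N}_{i-1}$ or all connected components of $\mathcal{N}_i$ are root-compatible; this index is $\mathrm{TD}(\mathbf{D})$. *)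

theory Defs
  imports "Graph_Theory.Graph_Theory" "HOL-Library.Extended_Nat"
begin

type_synonym 'p graph = "'p pair_pre_digraph"

definition communication_graph :: "'p set \<Rightarrow> 'p graph \<Rightarrow> bool" where
  "communication_graph Procs G \<longleftrightarrow>
     pair_wf_digraph G \<and> pverts G = Procs \<and> (\<forall>p\<in>Procs. (p, p) \<in> parcs G)"

definition In_nbrs :: "'p graph \<Rightarrow> 'p \<Rightarrow> 'p set" where
  "In_nbrs G p = {q. (q, p) \<in> parcs G}"

text \<open>Root components are represented by their node sets.\<close>

definition root_components :: "'p graph \<Rightarrow> 'p set set" where
  "root_components G =
     {R \<in> pre_digraph.sccs_verts (with_proj G). \<forall>(q, p) \<in> parcs G. p \<in> R \<longrightarrow> q \<in> R}"

definition rooted :: "'p graph \<Rightarrow> bool" where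
  "rooted G \<longleftrightarrow> (\<exists>!R. R \<in> root_components G)"

definition Root :: "'p graph \<Rightarrow> 'p set" where
  "Root G = (THE R. R \<in> root_components G)"

definition root_compatible :: "'p graph set \<Rightarrow> bool" where
  "root_compatible S \<longleftrightarrow> (\<Inter>G\<in>S. Root G) \<noteq> {}"

text \<open>
  An undirected graph on a node set \<open>V\<close> is given by its set of edges, each a set of two
  distinct nodes. (Loops would make no difference to the procedure: their label would be
  the set of all processes, so they would never be removed.)
\<close>

definition component_of :: "'v set set \<Rightarrow> 'v \<Rightarrow> 'v set" where
  "component_of E v = {w. (v, w) \<in> {(x, y). {x, y} \<in> E}\<^sup>*}"

definition components :: "'v set \<Rightarrow> 'v set set \<Rightarrow> 'v set set" where
  "components V E = component_of E ` V"

definition label :: "'p set \<Rightarrow> 'p graph set \<Rightarrow> 'p set" where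
  "label Procs e = {p \<in> Procs. \<forall>G\<in>e. \<forall>H\<in>e. In_nbrs G p = In_nbrs H p}"

definition indist_edges :: "'p set \<Rightarrow> 'p graph set \<Rightarrow> 'p graph set set" where
  "indist_edges Procs D =
     {{G, H} | G H. G \<in> D \<and> H \<in> D \<and> G \<noteq> H \<and> label Procs {G, H} \<noteq> {}}"

definition refine :: "'p set \<Rightarrow> 'p graph set \<Rightarrow> 'p graph set set \<Rightarrow> 'p graph set set" where
  "refine Procs D E =
     {e \<in> E. \<exists>C \<in> components D E. e \<subseteq> C \<and> (\<exists>G\<in>C. Root G \<subseteq> label Procs e)}"

text \<open>
  The edge set of the \<open>i\<close>-th graph of the decision procedure; its node set is always \<open>D\<close>.
  Indices start at 1, and the value at 0 is never used.
\<close>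

fun N_edges :: "'p set \<Rightarrow> 'p graph set \<Rightarrow> nat \<Rightarrow> 'p graph set set" where
  "N_edges Procs D 0 = indist_edges Procs D"
| "N_edges Procs D (Suc 0) = indist_edges Procs D"
| "N_edges Procs D (Suc (Suc i)) = refine Procs D (N_edges Procs D (Suc i))"

definition stops_at :: "'p set \<Rightarrow> 'p graph set \<Rightarrow> nat \<Rightarrow> bool" where
  "stops_at Procs D i \<longleftrightarrow>
     N_edges Procs D i = N_edges Procs D (i - 1) \<or>
     (\<forall>C \<in> components D (N_edges Procs D i). root_compatible C)"

text \<open>
  The least stopping index, as an extended natural number: it is \<open>\<infinity>\<close> if the
  procedure never stops, so that a finite bound on it includes termination.
\<close>

definition TD :: "'p set \<Rightarrow> 'p graph set \<Rightarrow> enat" where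
  "TD Procs D = (INF i \<in> {i. 2 \<le> i \<and> stops_at Procs D i}. enat i)"

end

theory Submission
  imports Defs
begin

text \<open>
  To a component \<open>C\<close> of the current graph associate the up-closed family of all sets of
  processes that include \<open>Root G\<close> for some \<open>G \<in> C\<close>; an edge of \<open>C\<close> survives iff its label
  belongs to this family. If an edge \<open>e\<close> inside a component \<open>C\<close> is removed exactly one step
  after it survived inside the bigger component \<open>C'\<close>, then its label belongs to the family of
  \<open>C'\<close> but not to that of \<open>C\<close>. Hence \<open>C \<noteq> C'\<close>, so some edge inside \<open>C'\<close> was itself removed
  in the previous step, and the argument can be repeated with that edge. An edge of \<open>\<N>\<^bsub>k-1\<^esub>\<close> missing
  from \<open>\<N>\<^bsub>k\<^esub>\<close> thus yields a strictly decreasing chain of \<open>k - 1\<close> such families; all of them contain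
  the set of all processes, and none contains \<open>\<emptyset>\<close> or the label of the last edge found.
\<close>

definition root_upset :: "'p set \<Rightarrow> 'p graph set \<Rightarrow> 'p set set" where
  "root_upset Procs C = {S. S \<subseteq> Procs \<and> (\<exists>G\<in>C. Root G \<subseteq> S)}"

lemma root_upset_mono: "C \<subseteq> C' \<Longrightarrow> root_upset Procs C \<subseteq> root_upset Procs C'"
  by (auto simp: root_upset_def)

lemma finite_root_upset: "finite Procs \<Longrightarrow> finite (root_upset Procs C)"
  by (rule finite_subset[of _ "Pow Procs"]) (auto simp: root_upset_def)

lemma Root_in_root_components: "rooted G \<Longrightarrow> Root G \<in> root_components G"
  unfolding rooted_def Root_def by (rule theI')

lemma Root_nonempty:
  assumes "rooted G"
  shows "Root G \<noteq> {}"
  using Root_in_root_components[OF assms]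
  by (simp add: root_components_def pre_digraph.sccs_verts_def)

lemma Root_subset:
  assumes "communication_graph Procs G" and "rooted G"
  shows "Root G \<subseteq> Procs"
proof
  fix p assume "p \<in> Root G"
  \<comment> \<open>Reachability is reflexive only at vertices, so the fact that \<open>p\<close>
    reaches itself already places \<open>p\<close> in \<open>pverts G\<close>.\<close>
  then have reach: "p \<rightarrow>\<^sup>*\<^bsub>with_proj G\<^esub> p"
    using Root_in_root_components[OF assms(2)]
    by (simp add: root_components_def pre_digraph.sccs_verts_def)
  have "pair_wf_digraph G"
    using assms(1) by (simp add: communication_graph_def)
  then interpret pair_wf_digraph G .
  from reach have "p \<in> pverts G"
    by (auto dest: reachable_in_verts)
  then show "p \<in> Procs"
    using assms(1) by (simp add: communication_graph_def)
qed

lemma component_of_refl: "v \<in> component_of E v"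
  by (simp add: component_of_def)

text \<open>Edges are undirected, so reachability is symmetric and components are equivalence
  classes.\<close>

lemma component_of_eq:
  assumes "w \<in> component_of E v"
  shows "component_of E w = component_of E v"
proof -
  let ?r = "{(x, y). {x, y} \<in> E}"
  have "sym ?r"
    by (auto simp: sym_def insert_commute)
  then have "sym (?r\<^sup>*)"
    by (rule sym_rtrancl)
  then have "(v, w) \<in> ?r\<^sup>*" "(w, v) \<in> ?r\<^sup>*"
    using assms by (auto simp: component_of_def sym_def)
  then show ?thesis
    unfolding component_of_def by (blast intro: rtrancl_trans)
qed

lemma component_of_edge: "{v, w} \<in> E \<Longrightarrow> {v, w} \<subseteq> component_of E v"
  by (auto simp: component_of_def)

lemma component_of_mono: "E' \<subseteq> E \<Longrightarrow> component_of E' v \<subseteq> component_of E v"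
  unfolding component_of_def
  by (intro Collect_mono impI) (erule rtrancl_mono[THEN subsetD, rotated], blast)

lemma component_of_subset:
  assumes "v \<in> D" and "\<And>e. e \<in> E \<Longrightarrow> e \<subseteq> D"
  shows "component_of E v \<subseteq> D"
proof
  fix w assume "w \<in> component_of E v"
  then have "(v, w) \<in> {(x, y). {x, y} \<in> E}\<^sup>*"
    by (simp add: component_of_def)
  then show "w \<in> D"
    by (induction rule: rtrancl_induct) (use assms in auto)
qed

text \<open>Every edge on a path from \<open>v\<close> lies inside the component of
  \<open>v\<close>, so the whole path survives in \<open>E'\<close>. Used contrapositively: a
  component that shrinks has lost one of its own edges.\<close>

lemma component_of_unchanged:
  assumes "\<And>e. e \<in> E \<Longrightarrow> e \<subseteq> component_of E v \<Longrightarrow> e \<in> E'"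
  shows "component_of E v \<subseteq> component_of E' v"
proof
  fix w assume "w \<in> component_of E v"
  then have "(v, w) \<in> {(x, y). {x, y} \<in> E}\<^sup>*"
    by (simp add: component_of_def)
  then show "w \<in> component_of E' v"
  proof (induction rule: rtrancl_induct)
    case base
    show ?case by (rule component_of_refl)
  next
    case (step x y)
    have "x \<in> component_of E v"
      using step.hyps by (simp add: component_of_def)
    then have "{x, y} \<subseteq> component_of E v"
      using step.hyps component_of_edge[of x y E] component_of_eq by fastforce
    then have "{x, y} \<in> E'"
      using step.hyps assms by blast
    then show ?case
      using step.IH by (auto simp: component_of_def intro: rtrancl_into_rtrancl)
  qed
qed

text \<open>Components are disjoint, so the only one including \<open>e\<close> is that of its
  endpoint \<open>v\<close>; the existential in \<open>refine\<close> becomes a single membership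
  test.\<close>

lemma in_refine_iff:
  assumes "e \<in> E" and "v \<in> D" and "v \<in> e" and "e \<subseteq> component_of E v"
  shows "e \<in> refine Procs D E \<longleftrightarrow> label Procs e \<in> root_upset Procs (component_of E v)"
proof -
  have "C = component_of E v" if "C \<in> components D E" "e \<subseteq> C" for C
    using that assms(3) component_of_eq by (fastforce simp: components_def)
  moreover have "component_of E v \<in> components D E"
    using assms(2) by (simp add: components_def)
  moreover have "label Procs e \<subseteq> Procs"
    by (auto simp: label_def)
  ultimately show ?thesis
    using assms(1,4) unfolding refine_def root_upset_def by blast
qed

lemma refine_subset: "refine Procs D E \<subseteq> E"
  by (auto simp: refine_def)

lemma N_edges_subset_indist: "N_edges Procs D i \<subseteq> indist_edges Procs D"
  by (induction Procs D i rule: N_edges.induct) (auto dest: subsetD[OF refine_subset])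

lemma N_edges_edge:
  assumes "e \<in> N_edges Procs D i"
  shows N_edges_subset_nodes: "e \<subseteq> D"
    and N_edges_label: "label Procs e \<noteq> {}"
    and N_edges_nonempty: "e \<noteq> {}"
    and N_edges_component: "v \<in> e \<Longrightarrow> e \<subseteq> component_of (N_edges Procs D i) v"
proof -
  obtain G H where e: "e = {G, H}" "G \<in> D" "H \<in> D" "label Procs e \<noteq> {}"
    using assms N_edges_subset_indist[of Procs D i] unfolding indist_edges_def by blast
  then show "e \<subseteq> D" "label Procs e \<noteq> {}" "e \<noteq> {}"
    by auto
  show "e \<subseteq> component_of (N_edges Procs D i) v" if "v \<in> e"
    using that e(1) assms component_of_edge[of G H] component_of_edge[of H G]
    by (auto simp: insert_commute)
qed

lemma in_N_edges_Suc_iff: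
  assumes "e \<in> N_edges Procs D (Suc k)" and "v \<in> e"
  shows "e \<in> N_edges Procs D (Suc (Suc k)) \<longleftrightarrow>
           label Procs e \<in> root_upset Procs (component_of (N_edges Procs D (Suc k)) v)"
  unfolding N_edges.simps(3)
proof (rule in_refine_iff)
  show "v \<in> D"
    using N_edges_subset_nodes[OF assms(1)] assms(2) by blast
  show "e \<subseteq> component_of (N_edges Procs D (Suc k)) v"
    using assms by (rule N_edges_component)
qed (use assms in auto)

text \<open>Each unit of \<open>k\<close> is paid for by one strict inclusion of families, and the
  summand 2 by two sets of processes outside the largest family. The edge changes from round to
  round, hence the induction is over arbitrary \<open>e\<close> and \<open>v\<close>.\<close>

lemma removal_bound:
  assumes fin: "finite Procs"
    and D: "\<And>G. G \<in> D \<Longrightarrow> communication_graph Procs G \<and> rooted G"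
    and "e \<in> N_edges Procs D (Suc k)" and "e \<notin> N_edges Procs D (Suc (Suc k))" and "v \<in> e"
  shows "card (root_upset Procs (component_of (N_edges Procs D (Suc k)) v)) + k + 2
           \<le> 2 ^ card Procs"
  using assms(3-5)
proof (induction k arbitrary: e v)
  case 0
  let ?C = "component_of (N_edges Procs D (Suc 0)) v"
  have "v \<in> D"
    using N_edges_subset_nodes[OF "0.prems"(1)] "0.prems"(3) by blast
  then have C: "?C \<subseteq> D"
    using N_edges_subset_nodes by (rule component_of_subset)
  have "label Procs e \<notin> root_upset Procs ?C"
    using "0.prems"(2) in_N_edges_Suc_iff[OF "0.prems"(1,3)] by blast
  moreover have "{} \<notin> root_upset Procs ?C"
    using C D Root_nonempty by (auto simp: root_upset_def)
  moreover have "label Procs e \<noteq> {}"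
    using "0.prems"(1) by (rule N_edges_label)
  moreover have "label Procs e \<subseteq> Procs"
    by (auto simp: label_def)
  moreover have "finite {{}, label Procs e}" "finite (root_upset Procs ?C)"
    using fin by (simp_all add: finite_root_upset)
  \<comment> \<open>The empty set is excluded because roots are nonempty, the label because
    \<open>e\<close> is removed; they differ because edges have nonempty labels.\<close>
  ultimately have "card (root_upset Procs ?C) + 2 = card (root_upset Procs ?C \<union> {{}, label Procs e})"
    by (subst card_Un_disjoint) auto
  also have "\<dots> \<le> card (Pow Procs)"
    using fin \<open>label Procs e \<subseteq> Procs\<close>
    by (intro card_mono) (auto simp: root_upset_def)
  finally show ?case
    using fin by (simp add: card_Pow)
next
  case (Suc k)
  let ?E = "N_edges Procs D (Suc k)" and ?E' = "N_edges Procs D (Suc (Suc k))"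
  let ?C = "component_of ?E v" and ?C' = "component_of ?E' v"
  have sub: "?E' \<subseteq> ?E"
    by (simp add: refine_subset)
  have C': "?C' \<subseteq> ?C"
    using sub by (rule component_of_mono)
  have "e \<in> ?E"
    using Suc.prems sub by blast
  then have "label Procs e \<in> root_upset Procs ?C"
    using in_N_edges_Suc_iff[OF _ Suc.prems(3)] Suc.prems(1) by simp
  moreover have "label Procs e \<notin> root_upset Procs ?C'"
    using Suc.prems(2) in_N_edges_Suc_iff[OF Suc.prems(1,3)] by blast
  ultimately have less: "root_upset Procs ?C' \<subset> root_upset Procs ?C"
    using root_upset_mono[OF C', of Procs] by blast
  then have "\<not> ?C \<subseteq> ?C'"
    using C' by auto
  \<comment> \<open>\<open>f\<close> is removed one round before \<open>e\<close>, which is what the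
    induction hypothesis asks for.\<close>
  then obtain f where f: "f \<in> ?E" "f \<subseteq> ?C" "f \<notin> ?E'"
    using component_of_unchanged[of ?E v ?E'] by blast
  obtain w where "w \<in> f"
    using f(1) N_edges_nonempty by blast
  \<comment> \<open>\<open>v\<close> need not be an endpoint of \<open>f\<close>, but
    \<open>f\<close> lies in \<open>?C\<close>, so the bound obtained at \<open>w\<close> concerns
    the family of \<open>?C\<close> itself.\<close>
  then have "component_of ?E w = ?C"
    using f(2) by (intro component_of_eq) blast
  then have "card (root_upset Procs ?C) + k + 2 \<le> 2 ^ card Procs"
    using Suc.IH[OF f(1,3) \<open>w \<in> f\<close>] by simp
  moreover have "card (root_upset Procs ?C') < card (root_upset Procs ?C)"
    using finite_root_upset[OF fin] less by (rule psubset_card_mono)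
  ultimately show ?case
    by simp
qed

theorem claim4:
  fixes Procs :: "'p set" and n :: nat and D :: "'p graph set"
  assumes "finite Procs" and "card Procs = n"
    and "D \<noteq> {}"
    and "\<And>G. G \<in> D \<Longrightarrow> communication_graph Procs G \<and> rooted G"
  shows "TD Procs D \<le> enat (2 ^ n)"
proof -
  obtain G where "G \<in> D"
    using assms(3) by blast
  then have "Procs \<noteq> {}"
    using assms(4) Root_nonempty Root_subset by blast
  then have "n \<noteq> 0"
    using assms(1,2) by auto
  \<comment> \<open>Needed both to write \<open>2 ^ n\<close> as \<open>Suc (Suc k)\<close> and
    because \<open>TD\<close> only admits indices from 2 on.\<close>
  then have two: "2 \<le> (2::nat) ^ n"
    using power_increasing[of 1 n "2::nat"] by simp
  then obtain k where k: "2 ^ n = Suc (Suc k)"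
    by (metis add_2_eq_Suc le_Suc_ex)
  have "N_edges Procs D (Suc k) \<subseteq> N_edges Procs D (Suc (Suc k))"
  proof (rule ccontr)
    assume "\<not> ?thesis"
    then obtain e where e: "e \<in> N_edges Procs D (Suc k)" "e \<notin> N_edges Procs D (Suc (Suc k))"
      by blast
    obtain v where v: "v \<in> e"
      using e(1) N_edges_nonempty by blast
    let ?U = "root_upset Procs (component_of (N_edges Procs D (Suc k)) v)"
    have "v \<in> D"
      using e(1) v N_edges_subset_nodes by blast
    then have "Root v \<subseteq> Procs"
      using assms(4) Root_subset by blast
    \<comment> \<open>This one member makes the count at least \<open>1 + k + 2\<close>, which
      exceeds \<open>2 ^ n = k + 2\<close>.\<close>
    then have "Procs \<in> ?U"
      using component_of_refl[of v] by (auto simp: root_upset_def intro!: bexI[of _ v])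
    then have "card ?U \<noteq> 0"
      using finite_root_upset[OF assms(1)] by (metis card_0_eq empty_iff)
    moreover have "card ?U + k + 2 \<le> 2 ^ n"
      using removal_bound[OF assms(1) assms(4) e v] assms(2) by simp
    ultimately show False
      using k by simp
  qed
  then have "N_edges Procs D (Suc (Suc k)) = N_edges Procs D (Suc k)"
    by (simp add: refine_subset subset_antisym)
  \<comment> \<open>The edge set is stationary at this index, so the first stopping condition holds;
    as \<open>TD\<close> is an infimum, one stopping index suffices.\<close>
  then have "stops_at Procs D (2 ^ n)"
    by (simp add: stops_at_def k)
  then show ?thesis
    unfolding TD_def using two by (intro INF_lower) simp
qed

end
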